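(* Let $\Omega$ be a Polish space, let $\Theta$ be the set of all probability measures on the Borel $\sigma$-field of $\Omega$, and let $\Theta_0\subset\Theta$ be relatively compact in the weak topology. Then $\Theta_0$ is uniformly asymptotically discernible. That is, there are sets $\Theta_k\subset\Theta$, $k=1,2,\ldots$, with $\Theta_k\subseteq\Theta_{k+1}$ and $\bigcup_{k=1}^\infty\Theta_k\cup\mathrm{cl}_c(\Theta_0)=\Theta$, and a sequence of tests $K_n=K_n(X_1,\ldots,X_n)$, such that for every $k=1,2,\ldots$ the (same) sequence of tests $K_n$ uniformly discerns the hypothesis $H_0:P\in\Theta_0$ and the alternative $H_k:P\in\Theta_k$.
   Context: $X_1,X_2,\ldots$ are i.i.d. with law $P\in\Theta$; $P$ also denotes probability for the infinite i.i.d. sequence. The weak topology on $\Theta$ is generated by the maps $P\mapsto\int f\,dP$, $f$ bounded continuous on $\Omega$; $\mathrm{cl}_c$ is closure in the weak topology, and a set is relatively compact if its closure in $\Theta$ is compact. A test $K_n=K_n(X_1,\ldots,X_n)$ is a measurable function of the first $n$ observations with values in $[0,1]$. Given sets $\Theta_0,\Theta_1'\subset\Theta$, a sequence of tests $K_n$ uniformly discerns the hypothesis $P\in\Theta_0$ and the alternative $P\in\Theta_1'$ if there is a positive random variable $N$ (a function of $X_1,X_2,\ldots$; it may depend on the pair $\Theta_0,\Theta_1'$) which is uniformly bounded, i.e. $\lim_{C\to\infty}\sup_{P\in\Theta_0\cup\Theta_1'}P(N>C)=0$, such that $P(K_n=0\text{ for all }n>N)=1$ for all $P\in\Theta_0$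 and $P(K_n=1\text{ for all }n>N)=1$ for all $P\in\Theta_1'$. *)

theory Defs
  imports "HOL-Probability.Probability"
begin

definition prob_laws :: "'a::topological_space measure set" where
  "prob_laws = {P. prob_space P \<and> sets P = sets borel}"

definition weak_topology :: "'a::topological_space measure topology" where
  "weak_topology = topology_generated_by
     {{P \<in> prob_laws. (\<integral>x. f x \<partial>P) \<in> U} |(f :: 'a \<Rightarrow> real) U.
        continuous_on UNIV f \<and> bounded (range f) \<and> open U}"

lemma topspace_weak_topology: "topspace weak_topology = prob_laws"
proof -
  have "\<exists>S. S \<in> {{P \<in> prob_laws. (\<integral>x. f x \<partial>P) \<in> U} |(f :: 'a \<Rightarrow> real) U.
        continuous_on UNIV f \<and> bounded (range f) \<and> open U} \<and> S = prob_laws"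
    by (rule exI[of _ prob_laws], simp, rule exI[of _ "\<lambda>_. 0"], rule exI[of _ UNIV])
       (auto simp: bounded_def)
  then show ?thesis
    unfolding weak_topology_def topology_generated_by_topspace by blast
qed

definition relatively_compact_laws :: "'a::topological_space measure set \<Rightarrow> bool" where
  "relatively_compact_laws A \<longleftrightarrow>
     compactin weak_topology (weak_topology closure_of A)"

text \<open>
  The law of an i.i.d. sequence with marginal \<open>P\<close>. The observations are the coordinates of the
  sequence space, counted from 0: \<open>\<omega> i\<close> is the observation usually written with index \<open>i + 1\<close>.
\<close>

definition iid_law :: "'a measure \<Rightarrow> (nat \<Rightarrow> 'a) measure" where
  "iid_law P = PiM UNIV (\<lambda>_. P)"

text \<open>
  \<open>K n\<close> is a function on the space of \<open>n\<close>-tuples; on a sequence \<open>\<omega>\<close> of observations it is evaluated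
  at the restriction of \<open>\<omega>\<close> to \<open>{..<n}\<close>.
\<close>

definition test_sequence :: "(nat \<Rightarrow> (nat \<Rightarrow> 'a::topological_space) \<Rightarrow> real) \<Rightarrow> bool" where
  "test_sequence K \<longleftrightarrow>
     (\<forall>n. K n \<in> borel_measurable (PiM {..<n} (\<lambda>_. borel)) \<and>
          (\<forall>x \<in> space (PiM {..<n} (\<lambda>_. borel :: 'a measure)). K n x \<in> {0..1}))"

text \<open>
  The supremum is taken in \<^typ>\<open>ennreal\<close>, so that it is 0 when both hypotheses are empty.
\<close>

definition uniformly_discerns ::
  "(nat \<Rightarrow> (nat \<Rightarrow> 'a::topological_space) \<Rightarrow> real) \<Rightarrow> 'a measure set \<Rightarrow> 'a measure set \<Rightarrow> bool" where
  "uniformly_discerns K A B \<longleftrightarrow>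
     (\<exists>N :: (nat \<Rightarrow> 'a) \<Rightarrow> real.
        N \<in> borel_measurable (PiM UNIV (\<lambda>_. borel)) \<and> (\<forall>\<omega>. N \<omega> > 0) \<and>
        ((\<lambda>C::real. SUP P\<in>A \<union> B. emeasure (iid_law P) {\<omega> \<in> space (iid_law P). N \<omega> > C})
           \<longlongrightarrow> 0) at_top \<and>
        (\<forall>P\<in>A. emeasure (iid_law P) {\<omega> \<in> space (iid_law P).
            \<forall>n. real n > N \<omega> \<longrightarrow> K n (restrict \<omega> {..<n}) = 0} = 1) \<and>
        (\<forall>P\<in>B. emeasure (iid_law P) {\<omega> \<in> space (iid_law P).
            \<forall>n. real n > N \<omega> \<longrightarrow> K n (restrict \<omega> {..<n}) = 1} = 1))"

definition uniformly_asymptotically_discernible :: "'a::topological_space measure set \<Rightarrow> bool" where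
  "uniformly_asymptotically_discernible A \<longleftrightarrow>
     (\<exists>(\<Theta> :: nat \<Rightarrow> 'a measure set) K.
        (\<forall>k\<ge>1. \<Theta> k \<subseteq> prob_laws \<and> \<Theta> k \<subseteq> \<Theta> (k + 1)) \<and>
        (\<Union>k\<in>{1..}. \<Theta> k) \<union> (weak_topology closure_of A) = prob_laws \<and>
        test_sequence K \<and>
        (\<forall>k\<ge>1. uniformly_discerns K A (\<Theta> k)))"

end

theory Submission
  imports Defs "HOL-Real_Asymp.Real_Asymp"
begin

text \<open>
  On a Polish space there is a sequence \<open>F\<close> of continuous functions with values in \<open>[0,1]\<close> whose
  integrals determine a probability law (\<open>measure_determining_sequence\<close>). So the map
  \<open>P \<mapsto> (\<integral>F i dP)\<^sub>i\<close> into the metrizable product space \<open>nat \<Rightarrow> real\<close> is injective, and it is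
  continuous for the weak topology by definition of that topology. The image \<open>S\<close> of the weak closure
  of \<open>\<Theta>\<^sub>0\<close> is therefore compact, hence closed, and a law lies outside the closure exactly if its
  moment vector has positive distance from \<open>S\<close>. This replaces a compact set of laws by a closed set
  of points, without any metrization of the weak topology; \<open>\<Theta>\<^sub>k\<close> consists of the laws whose
  moment vector is at distance at least \<open>1/k\<close> from all points of \<open>S\<close>.

  The test \<open>K\<^sub>n\<close> accepts if the empirical moment vector is within \<open>r\<^sub>n\<close> of \<open>S\<close>, where \<open>r\<^sub>n\<close>
  tends to 0 slowly. Hoeffding's inequality, applied to the first \<open>n + 1\<close> coordinates, bounds the
  probability that the empirical moments are at distance \<open>r\<^sub>n\<close> or more from the true ones by a
  summable sequence that is the same for all laws (\<open>empirical_moments_concentration\<close>). If this does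
  not happen, then \<open>K\<^sub>n\<close> is right under \<open>\<Theta>\<^sub>0\<close>, and it is right under \<open>\<Theta>\<^sub>k\<close> as soon as
  \<open>2 r\<^sub>n \<le> 1/k\<close>.

  Uniformly summable error probabilities suffice (\<open>uniformly_discerns_if_summable_errors\<close>): the
  random variable \<open>N\<close> has to be a function of the observations alone, and the time from which
  the tests no longer change their value is one. By the Borel-Cantelli lemma this value is the right
  one, and the time exceeds \<open>j\<close> only if \<open>K\<^sub>n\<close> errs for some \<open>n \<ge> j\<close>.
\<close>

section \<open>The law of an i.i.d. sequence\<close>

lemma sets_iid_law:
  assumes "P \<in> prob_laws"
  shows "sets (iid_law P) = sets (PiM UNIV (\<lambda>_. borel))"
  using assms unfolding iid_law_def prob_laws_def by (intro sets_PiM_cong) auto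

lemma prob_space_iid_law:
  assumes "P \<in> prob_laws"
  shows "prob_space (iid_law P)"
  using assms unfolding iid_law_def prob_laws_def by (intro prob_space_PiM) auto

lemma distr_iid_law_coordinate:
  assumes "P \<in> prob_laws"
  shows "distr (iid_law P) P (\<lambda>\<omega>. \<omega> j) = P"
  unfolding iid_law_def using assms by (intro distr_PiM_component) (auto simp: prob_laws_def)

lemma measurable_iid_law_coordinate: "(\<lambda>\<omega>. \<omega> j) \<in> measurable (iid_law P) P"
  unfolding iid_law_def using measurable_component_singleton[of j UNIV "\<lambda>_. P"] by simp

lemma indep_vars_iid_law_coordinates:
  assumes "P \<in> prob_laws"
  shows "prob_space.indep_vars (iid_law P) (\<lambda>_. P) (\<lambda>j \<omega>. \<omega> j) UNIV"
proof -
  interpret prob_space "iid_law P" by (rule prob_space_iid_law[OF assms])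
  have "distr (iid_law P) (PiM UNIV (\<lambda>_. P)) (\<lambda>\<omega>. \<lambda>j\<in>UNIV. \<omega> j) = iid_law P"
    by (simp add: restrict_def iid_law_def distr_id2)
  moreover have "(\<Pi>\<^sub>M j\<in>UNIV. distr (iid_law P) P (\<lambda>\<omega>. \<omega> j)) = iid_law P"
    by (simp add: distr_iid_law_coordinate[OF assms]) (simp add: iid_law_def)
  ultimately have "distr (iid_law P) (PiM UNIV (\<lambda>_. P)) (\<lambda>\<omega>. \<lambda>j\<in>UNIV. \<omega> j)
      = (\<Pi>\<^sub>M j\<in>UNIV. distr (iid_law P) P (\<lambda>\<omega>. \<omega> j))"
    by (simp only:)
  then show ?thesis
    by (intro indep_vars_iff_distr_eq_PiM[THEN iffD2] measurable_iid_law_coordinate) simp_all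
qed

lemma measurable_test_of_observations:
  assumes "test_sequence K"
  shows "(\<lambda>\<omega>. K n (restrict \<omega> {..<n})) \<in> borel_measurable (PiM UNIV (\<lambda>_. borel))"
proof -
  have "K n \<in> borel_measurable (PiM {..<n} (\<lambda>_. borel))"
    using assms by (simp add: test_sequence_def)
  then show ?thesis
    by (rule measurable_compose[rotated]) (rule measurable_restrict_subset, simp)
qed

section \<open>Uniformly summable error probabilities\<close>

text \<open>
  A sequence that never becomes constant gets an arbitrary value. This is harmless because almost all
  sequences of test results will turn out to become constant.
\<close>

definition stabilization_time :: "(nat \<Rightarrow> real) \<Rightarrow> nat" where
  "stabilization_time Y = (LEAST m. \<forall>n\<ge>m. Y n = Y m)"

lemma stabilization_time_le:
  assumes "\<forall>n\<ge>m. Y n = c"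
  shows "stabilization_time Y \<le> m"
  unfolding stabilization_time_def using assms by (intro Least_le) auto

lemma stable_after_stabilization_time:
  assumes "\<forall>n\<ge>m. Y n = c" and "n \<ge> stabilization_time Y"
  shows "Y n = c"
proof -
  have "\<forall>n\<ge>m. Y n = Y m"
    using assms(1) by auto
  then have *: "\<forall>n\<ge>stabilization_time Y. Y n = Y (stabilization_time Y)"
    unfolding stabilization_time_def by (rule LeastI)
  then have "Y n = Y (max m n)"
    using assms(2) by (metis max.coboundedI2)
  then show ?thesis
    using assms(1) by simp
qed

lemma measurable_stabilization_time:
  fixes X :: "nat \<Rightarrow> 'a \<Rightarrow> real"
  assumes "\<And>n. X n \<in> borel_measurable M"
  shows "(\<lambda>\<omega>. stabilization_time (\<lambda>n. X n \<omega>)) \<in> measurable M (count_space UNIV)"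
proof -
  have "Measurable.pred M (\<lambda>\<omega>. X n \<omega> = X k \<omega>)" for n k
    using borel_measurable_eq[OF assms assms, of n k] by (simp add: pred_def)
  then have "Measurable.pred M (\<lambda>\<omega>. \<forall>n\<in>{k..}. X n \<omega> = X k \<omega>)" for k
    by (intro pred_intros_countable_bounded) auto
  then have "(\<lambda>\<omega>. LEAST k. \<forall>n\<in>{k..}. X n \<omega> = X k \<omega>) \<in> measurable M (count_space UNIV)"
    by (rule measurable_Least)
  then show ?thesis
    by (simp only: stabilization_time_def Ball_def atLeast_iff)
qed

text \<open>
  Stated for an arbitrary limiting value \<open>c\<close>, so that it serves both hypotheses. The first claim is
  the union bound: a sequence that equals \<open>c\<close> from time \<open>j\<close> on has stabilized by then.
\<close>

lemma (in prob_space) stabilization_if_summable_errors: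
  assumes X [measurable]: "\<And>n. X n \<in> borel_measurable M"
    and b: "summable b" "\<And>n. 0 \<le> b n"
    and err: "\<And>n. n \<ge> m \<Longrightarrow> prob {\<omega> \<in> space M. X n \<omega> \<noteq> c} \<le> b n"
  shows "j \<ge> m \<Longrightarrow> emeasure M {\<omega> \<in> space M. stabilization_time (\<lambda>n. X n \<omega>) > j}
           \<le> ennreal (\<Sum>n. b (n + j))"
    and "emeasure M {\<omega> \<in> space M.
           \<forall>n. real n > 1 + real (stabilization_time (\<lambda>n. X n \<omega>)) \<longrightarrow> X n \<omega> = c} = 1"
proof -
  note [measurable] = measurable_stabilization_time[of X M, OF X]
  define E where "E n = {\<omega> \<in> space M. X n \<omega> \<noteq> c}" for n
  have E_sets: "E n \<in> sets M" for n
    unfolding E_def by measurable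
  have E: "emeasure M (E n) \<le> ennreal (b n)" if "n \<ge> m" for n
    using err[OF that] by (simp add: E_def emeasure_eq_measure b(2))
  show "emeasure M {\<omega> \<in> space M. stabilization_time (\<lambda>n. X n \<omega>) > j} \<le> ennreal (\<Sum>n. b (n + j))"
    if j: "j \<ge> m"
  proof -
    have summable: "summable (\<lambda>n. b (n + j))"
      using b(1) by (simp add: summable_iff_shift)
    have "{\<omega> \<in> space M. stabilization_time (\<lambda>n. X n \<omega>) > j} \<subseteq> (\<Union>n. E (n + j))"
    proof
      fix \<omega> assume \<omega>: "\<omega> \<in> {\<omega> \<in> space M. stabilization_time (\<lambda>n. X n \<omega>) > j}"
      then have "\<not> (\<forall>n\<ge>j. X n \<omega> = c)"
        using stabilization_time_le[of j "\<lambda>n. X n \<omega>" c] by auto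
      then obtain n where n: "n \<ge> j" "X n \<omega> \<noteq> c"
        by blast
      have "\<omega> \<in> E (n - j + j)"
        using \<omega> n by (simp add: E_def)
      then show "\<omega> \<in> (\<Union>n. E (n + j))"
        by blast
    qed
    then have "emeasure M {\<omega> \<in> space M. stabilization_time (\<lambda>n. X n \<omega>) > j}
        \<le> emeasure M (\<Union>n. E (n + j))"
      by (rule emeasure_mono) (intro sets.countable_UN image_subsetI E_sets)
    also have "\<dots> \<le> (\<Sum>n. emeasure M (E (n + j)))"
      by (rule emeasure_subadditive_countably) (intro image_subsetI E_sets)
    also have "\<dots> \<le> (\<Sum>n. ennreal (b (n + j)))"
      using j by (intro suminf_le E summableI) simp
    also have "\<dots> = ennreal (\<Sum>n. b (n + j))"
      using summable by (intro suminf_ennreal2 b)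
    finally show ?thesis .
  qed
  have "norm (prob (E n)) \<le> b n" if "n \<ge> m" for n
    using err[OF that] by (simp add: E_def)
  then have "summable (\<lambda>n. prob (E n))"
    by (rule summable_comparison_test'[OF b(1)])
  then have "AE \<omega> in M. eventually (\<lambda>n. \<omega> \<in> space M - E n) sequentially"
    by (intro borel_cantelli_AE1 E_sets) (simp_all add: emeasure_eq_measure)
  then have "AE \<omega> in M. \<forall>n. real n > 1 + real (stabilization_time (\<lambda>n. X n \<omega>)) \<longrightarrow> X n \<omega> = c"
  proof (rule eventually_mono)
    fix \<omega> assume "eventually (\<lambda>n. \<omega> \<in> space M - E n) sequentially"
    then obtain m' where m': "\<forall>n\<ge>m'. X n \<omega> = c"
      by (auto simp: eventually_sequentially E_def)
    show "\<forall>n. real n > 1 + real (stabilization_time (\<lambda>n. X n \<omega>)) \<longrightarrow> X n \<omega> = c"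
      using stable_after_stabilization_time[of m' "\<lambda>n. X n \<omega>", OF m'] by simp
  qed
  then show "emeasure M {\<omega> \<in> space M.
      \<forall>n. real n > 1 + real (stabilization_time (\<lambda>n. X n \<omega>)) \<longrightarrow> X n \<omega> = c} = 1"
    by (intro emeasure_eq_1_AE) measurable
qed

text \<open>
  The stabilization time, increased by 1 to make it positive, can serve as \<open>N\<close>: it refers to no
  particular law, and its tails are bounded by those of the series \<open>b\<close>, the same for all laws.
\<close>

lemma uniformly_discerns_if_summable_errors:
  assumes K: "test_sequence K" and AB: "A \<subseteq> prob_laws" "B \<subseteq> prob_laws"
    and b: "summable b" "\<And>n. 0 \<le> b n"
    and errA: "\<And>P n. P \<in> A \<Longrightarrow> n \<ge> m \<Longrightarrow>
      measure (iid_law P) {\<omega> \<in> space (iid_law P). K n (restrict \<omega> {..<n}) \<noteq> 0} \<le> b n"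
    and errB: "\<And>P n. P \<in> B \<Longrightarrow> n \<ge> m \<Longrightarrow>
      measure (iid_law P) {\<omega> \<in> space (iid_law P). K n (restrict \<omega> {..<n}) \<noteq> 1} \<le> b n"
  shows "uniformly_discerns K A B"
proof -
  define X where "X n \<omega> = K n (restrict \<omega> {..<n})" for n \<omega>
  define N where "N \<omega> = 1 + real (stabilization_time (\<lambda>n. X n \<omega>))" for \<omega>
  define tail where "tail j = (\<Sum>n. b (n + j))" for j
  have X: "X n \<in> borel_measurable (PiM UNIV (\<lambda>_. borel))" for n
    using measurable_test_of_observations[OF K, of n] by (simp add: X_def[abs_def])
  have time: "(\<lambda>\<omega>. stabilization_time (\<lambda>n. X n \<omega>))
      \<in> measurable (PiM UNIV (\<lambda>_. borel)) (count_space UNIV)"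
    by (rule measurable_stabilization_time[OF X])
  have X_law: "X n \<in> borel_measurable (iid_law P)" if "P \<in> prob_laws" for P n
    using X[of n] by (simp cong: measurable_cong_sets add: sets_iid_law[OF that])
  have "N \<in> borel_measurable (PiM UNIV (\<lambda>_. borel))"
    unfolding N_def using time by measurable
  moreover have "\<forall>\<omega>. N \<omega> > 0"
    by (simp add: N_def)
  moreover have "((\<lambda>C. SUP P\<in>A \<union> B. emeasure (iid_law P) {\<omega> \<in> space (iid_law P). N \<omega> > C})
      \<longlongrightarrow> 0) at_top"
  proof (rule tendsto_sandwich[where f = "\<lambda>_. 0"])
    have "tail \<longlonglongrightarrow> 0"
      unfolding tail_def by (rule suminf_exist_split2[OF b(1)])
    moreover have "filterlim (\<lambda>C::real. nat \<lfloor>C - 1\<rfloor>) sequentially at_top"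
      by (intro filterlim_compose[OF filterlim_nat_sequentially]
          filterlim_compose[OF filterlim_floor_sequentially]) real_asymp
    ultimately have "((\<lambda>C::real. tail (nat \<lfloor>C - 1\<rfloor>)) \<longlongrightarrow> 0) at_top"
      by (rule filterlim_compose)
    then show "((\<lambda>C::real. ennreal (tail (nat \<lfloor>C - 1\<rfloor>))) \<longlongrightarrow> 0) at_top"
      using tendsto_ennrealI by fastforce
    show "\<forall>\<^sub>F C in at_top. (SUP P\<in>A \<union> B. emeasure (iid_law P) {\<omega> \<in> space (iid_law P). N \<omega> > C})
        \<le> ennreal (tail (nat \<lfloor>C - 1\<rfloor>))"
      using eventually_ge_at_top[of "real m + 1"]
    proof eventually_elim
      case (elim C)
      let ?j = "nat \<lfloor>C - 1\<rfloor>"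
      have j: "?j \<ge> m"
        using elim by linarith
      show ?case
      proof (rule SUP_least)
        fix P assume P: "P \<in> A \<union> B"
        then have law: "P \<in> prob_laws" using AB by auto
        interpret prob_space "iid_law P" by (rule prob_space_iid_law[OF law])
        note [measurable] = measurable_stabilization_time[of X "iid_law P", OF X_law[OF law]]
        have "{\<omega> \<in> space (iid_law P). N \<omega> > C}
            \<subseteq> {\<omega> \<in> space (iid_law P). stabilization_time (\<lambda>n. X n \<omega>) > ?j}"
          using elim unfolding N_def by safe linarith
        then have "emeasure (iid_law P) {\<omega> \<in> space (iid_law P). N \<omega> > C}
            \<le> emeasure (iid_law P) {\<omega> \<in> space (iid_law P). stabilization_time (\<lambda>n. X n \<omega>) > ?j}"
          by (intro emeasure_mono) measurable
        also have "\<dots> \<le> ennreal (tail ?j)"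
        proof (cases "P \<in> A")
          case True
          then show ?thesis unfolding tail_def
            by (intro stabilization_if_summable_errors(1)[where c = 0 and m = m] X_law law b j)
              (simp add: X_def errA)
        next
          case False
          with P show ?thesis unfolding tail_def
            by (intro stabilization_if_summable_errors(1)[where c = 1 and m = m] X_law law b j)
              (simp add: X_def errB)
        qed
        finally show "emeasure (iid_law P) {\<omega> \<in> space (iid_law P). N \<omega> > C} \<le> ennreal (tail ?j)" .
      qed
    qed
  qed auto
  moreover have "emeasure (iid_law P) {\<omega> \<in> space (iid_law P).
      \<forall>n. real n > N \<omega> \<longrightarrow> K n (restrict \<omega> {..<n}) = 0} = 1" if "P \<in> A" for P
  proof -
    have law: "P \<in> prob_laws" using that AB by auto
    interpret prob_space "iid_law P" by (rule prob_space_iid_law[OF law])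
    show ?thesis
      unfolding N_def X_def[symmetric]
      by (intro stabilization_if_summable_errors(2)[where b = b and m = m] X_law law b)
        (simp add: X_def errA[OF that])
  qed
  moreover have "emeasure (iid_law P) {\<omega> \<in> space (iid_law P).
      \<forall>n. real n > N \<omega> \<longrightarrow> K n (restrict \<omega> {..<n}) = 1} = 1" if "P \<in> B" for P
  proof -
    have law: "P \<in> prob_laws" using that AB by auto
    interpret prob_space "iid_law P" by (rule prob_space_iid_law[OF law])
    show ?thesis
      unfolding N_def X_def[symmetric]
      by (intro stabilization_if_summable_errors(2)[where b = b and m = m] X_law law b)
        (simp add: X_def errB[OF that])
  qed
  ultimately show ?thesis
    unfolding uniformly_discerns_def by (intro exI[of _ N]) simp
qed

section \<open>A measure-determining sequence of continuous functions\<close>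

definition indicator_approx :: "'a::metric_space set \<Rightarrow> nat \<Rightarrow> 'a \<Rightarrow> real" where
  "indicator_approx U k x = min 1 (real k * infdist x (- U))"

lemma indicator_approx_bounds: "indicator_approx U k x \<in> {0..1}"
  by (simp add: indicator_approx_def infdist_nonneg)

lemma continuous_indicator_approx: "continuous_on UNIV (indicator_approx U k)"
  unfolding indicator_approx_def by (intro continuous_intros)

text \<open>
  The case of the whole space is excluded because \<^const>\<open>infdist\<close> to the empty set is 0 by convention.
\<close>

lemma indicator_approx_tendsto:
  assumes "open U" "U \<noteq> UNIV"
  shows "(\<lambda>k. indicator_approx U k x) \<longlonglongrightarrow> indicator U x"
proof (cases "x \<in> U")
  case True
  then have pos: "infdist x (- U) > 0"
    using assms by (intro infdist_pos_not_in_closed) auto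
  have "eventually (\<lambda>k. indicator_approx U k x = 1) sequentially"
    using eventually_ge_at_top[of "nat \<lceil>1 / infdist x (- U)\<rceil>"]
  proof eventually_elim
    case (elim k)
    then have "1 / infdist x (- U) \<le> real k" by linarith
    with pos show ?case
      by (simp add: indicator_approx_def field_simps)
  qed
  with True show ?thesis
    by (simp add: tendsto_eventually)
next
  case False
  then show ?thesis
    by (simp add: indicator_approx_def)
qed

lemma continuous_imp_measurable_law:
  assumes "P \<in> prob_laws" "continuous_on UNIV f"
  shows "f \<in> borel_measurable P"
  using borel_measurable_continuous_onI[OF assms(2)] assms(1)
  by (simp add: prob_laws_def cong: measurable_cong_sets)

lemma integral_indicator_approx_tendsto:
  assumes P: "P \<in> prob_laws" and U: "open U" "U \<noteq> UNIV"
  shows "(\<lambda>k. \<integral>x. indicator_approx U k x \<partial>P) \<longlonglongrightarrow> measure P U"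
proof -
  interpret prob_space P using P by (simp add: prob_laws_def)
  have sets: "U \<in> sets P" and space: "space P = UNIV"
    using P U sets_eq_imp_space_eq[of P borel] by (auto simp: prob_laws_def)
  have "(\<lambda>k. \<integral>x. indicator_approx U k x \<partial>P) \<longlonglongrightarrow> (\<integral>x. indicator U x \<partial>P)"
  proof (rule integral_dominated_convergence[where w = "\<lambda>_. 1"])
    show "AE x in P. norm (indicator_approx U k x) \<le> 1" for k
      using indicator_approx_bounds[of U k] by auto
  qed (use P U sets continuous_indicator_approx in
      \<open>auto intro: continuous_imp_measurable_law indicator_approx_tendsto\<close>)
  then show ?thesis
    by (simp add: space)
qed

text \<open>
  The finite intersections of the members of a countable base form a countable \<open>\<pi>\<close>-system that
  generates the Borel sets, so it is enough to recover the measures of these open sets, and each of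
  them is the limit of the integrals of countably many continuous functions.
\<close>

lemma measure_determining_sequence:
  obtains F :: "nat \<Rightarrow> 'a::{metric_space, second_countable_topology} \<Rightarrow> real"
  where "\<And>i. continuous_on UNIV (F i)" "\<And>i x. F i x \<in> {0..1}"
    "\<And>P Q. P \<in> prob_laws \<Longrightarrow> Q \<in> prob_laws \<Longrightarrow> (\<And>i. (\<integral>x. F i x \<partial>P) = (\<integral>x. F i x \<partial>Q)) \<Longrightarrow> P = Q"
proof -
  obtain \<B> :: "'a set set" where \<B>: "countable \<B>" "topological_basis \<B>"
    using ex_countable_basis by blast
  define \<U> where "\<U> = Inter ` {\<F>. finite \<F> \<and> \<F> \<subseteq> \<B>}"
  have countable: "countable \<U>"
    unfolding \<U>_def by (intro countable_image countable_Collect_finite_subset \<B>)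
  have UNIV: "UNIV \<in> \<U>"
    unfolding \<U>_def by (rule image_eqI[of _ _ "{}"]) auto
  have "open U" if "U \<in> \<U>" for U
    using that topological_basis_open[OF \<B>(2)] by (auto simp: \<U>_def intro!: open_Inter)
  note open\<U> = this
  have "U \<inter> V \<in> \<U>" if UV: "U \<in> \<U>" "V \<in> \<U>" for U V
  proof -
    obtain \<F> \<G> where "finite \<F>" "\<F> \<subseteq> \<B>" "U = \<Inter>\<F>" "finite \<G>" "\<G> \<subseteq> \<B>" "V = \<Inter>\<G>"
      using UV by (auto simp: \<U>_def)
    then show ?thesis
      unfolding \<U>_def by (intro image_eqI[of _ _ "\<F> \<union> \<G>"]) auto
  qed
  then have stable: "Int_stable \<U>"
    by (auto simp: Int_stable_def)
  have gen: "sets borel = sigma_sets UNIV \<U>"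
  proof
    have "\<B> \<subseteq> \<U>"
    proof
      fix B assume "B \<in> \<B>"
      then show "B \<in> \<U>"
        unfolding \<U>_def by (intro image_eqI[of _ _ "{B}"]) auto
    qed
    then show "sets borel \<subseteq> sigma_sets UNIV \<U>"
      by (simp add: borel_eq_countable_basis[OF \<B>] sigma_sets_mono')
    have "\<U> \<subseteq> sets borel"
      using open\<U> by auto
    then show "sigma_sets UNIV \<U> \<subseteq> sets borel"
      using sets.sigma_sets_subset[of \<U> borel] by simp
  qed
  define F where "F n = (case prod_decode n of (j, k) \<Rightarrow> indicator_approx (from_nat_into \<U> j) k)" for n
  show ?thesis
  proof (rule that[of F])
    show "continuous_on UNIV (F i)" for i
      by (simp add: F_def continuous_indicator_approx split: prod.split)
    show "F i x \<in> {0..1}" for i x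
      by (cases "prod_decode i") (simp only: F_def prod.case indicator_approx_bounds)
    fix P Q :: "'a measure"
    assume P: "P \<in> prob_laws" and Q: "Q \<in> prob_laws"
      and eq: "\<And>i. (\<integral>x. F i x \<partial>P) = (\<integral>x. F i x \<partial>Q)"
    interpret P: prob_space P using P by (simp add: prob_laws_def)
    interpret Q: prob_space Q using Q by (simp add: prob_laws_def)
    have space: "space P = UNIV" "space Q = UNIV"
      using P Q sets_eq_imp_space_eq[of _ borel] by (auto simp: prob_laws_def)
    have "measure P U = measure Q U" if U: "U \<in> \<U>" for U
    proof (cases "U = UNIV")
      case True
      then show ?thesis
        using P.prob_space Q.prob_space space by simp
    next
      case False
      obtain j where j: "from_nat_into \<U> j = U"
        using U from_nat_into_surj[OF countable] by blast
      have "(\<integral>x. indicator_approx U k x \<partial>P) = (\<integral>x. indicator_approx U k x \<partial>Q)" for k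
        using eq[of "prod_encode (j, k)"] j by (simp add: F_def)
      then have "(\<lambda>k. \<integral>x. indicator_approx U k x \<partial>P) \<longlonglongrightarrow> measure Q U"
        using integral_indicator_approx_tendsto[OF Q open\<U>[OF U] False] by simp
      with integral_indicator_approx_tendsto[OF P open\<U>[OF U] False] show ?thesis
        by (rule LIMSEQ_unique)
    qed
    then show "P = Q"
      using P Q stable gen UNIV
      by (intro measure_eqI_generator_eq[where E = \<U> and \<Omega> = UNIV and A = "\<lambda>_. UNIV"])
        (auto simp: prob_laws_def P.emeasure_eq_measure Q.emeasure_eq_measure)
  qed
qed

section \<open>Moment vectors\<close>

definition moments :: "(nat \<Rightarrow> 'a \<Rightarrow> real) \<Rightarrow> 'a measure \<Rightarrow> nat \<Rightarrow> real" where
  "moments F P i = (\<integral>x. F i x \<partial>P)"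

definition empirical_moments :: "(nat \<Rightarrow> 'a \<Rightarrow> real) \<Rightarrow> nat \<Rightarrow> (nat \<Rightarrow> 'a) \<Rightarrow> nat \<Rightarrow> real" where
  "empirical_moments F n x i = (\<Sum>j<n. F i (x j)) / real n"

lemma continuous_map_moments:
  fixes F :: "nat \<Rightarrow> 'a::topological_space \<Rightarrow> real"
  assumes "\<And>i. continuous_on UNIV (F i)" "\<And>i. bounded (range (F i))"
  shows "continuous_map weak_topology euclidean (moments F)"
proof -
  have "continuous_map weak_topology euclidean (\<lambda>P. moments F P i)" for i
    unfolding continuous_map_def topspace_weak_topology
  proof (intro conjI allI impI)
    fix U :: "real set" assume "openin euclidean U"
    then show "openin weak_topology {P \<in> prob_laws. moments F P i \<in> U}"
      unfolding weak_topology_def moments_def using assms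
      by (intro topology_generated_by_Basis) auto
  qed auto
  then show ?thesis
    by (simp add: continuous_map_componentwise_UNIV flip: euclidean_product_topology)
qed

lemma empirical_moments_restrict: "empirical_moments F n (restrict \<omega> {..<n}) = empirical_moments F n \<omega>"
  by (simp add: empirical_moments_def fun_eq_iff)

lemma measurable_empirical_moments:
  fixes F :: "nat \<Rightarrow> 'a::topological_space \<Rightarrow> real"
  assumes "\<And>i. continuous_on UNIV (F i)" and "{..<n} \<subseteq> I"
  shows "empirical_moments F n \<in> borel_measurable (PiM I (\<lambda>_. borel))"
proof (rule measurable_coordinatewise_then_product)
  fix i
  have [measurable]: "F i \<in> borel_measurable borel"
    by (rule borel_measurable_continuous_onI[OF assms(1)])
  have [measurable]: "(\<lambda>\<omega>. \<omega> j) \<in> measurable (PiM I (\<lambda>_. borel)) (borel :: 'a measure)" if "j < n" for j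
    using that assms(2) by (intro measurable_component_singleton) auto
  show "(\<lambda>x. empirical_moments F n x i) \<in> borel_measurable (PiM I (\<lambda>_. borel))"
    unfolding empirical_moments_def by measurable
qed

lemma Hoeffding_empirical_moment:
  fixes F :: "nat \<Rightarrow> 'a::topological_space \<Rightarrow> real"
  assumes F: "\<And>i. continuous_on UNIV (F i)" "\<And>i x. F i x \<in> {0..1}"
    and P: "P \<in> prob_laws" and n: "n > 0" and \<epsilon>: "\<epsilon> \<ge> 0"
  shows "measure (iid_law P) {\<omega> \<in> space (iid_law P). \<bar>empirical_moments F n \<omega> i - moments F P i\<bar> \<ge> \<epsilon>}
           \<le> 2 * exp (- 2 * real n * \<epsilon>\<^sup>2)"
proof -
  interpret prob_space "iid_law P" by (rule prob_space_iid_law[OF P])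
  note [measurable] = measurable_iid_law_coordinate[of _ P]
  have F_meas [measurable]: "F i \<in> borel_measurable P"
    by (rule continuous_imp_measurable_law[OF P F(1)])
  have distr: "distr (iid_law P) borel (\<lambda>\<omega>. F i (\<omega> j)) = distr P borel (F i)" for j
  proof -
    have "distr P borel (F i) = distr (distr (iid_law P) P (\<lambda>\<omega>. \<omega> j)) borel (F i)"
      by (simp add: distr_iid_law_coordinate[OF P])
    also have "\<dots> = distr (iid_law P) borel (\<lambda>\<omega>. F i (\<omega> j))"
      by (subst distr_distr) (auto simp: o_def)
    finally show ?thesis ..
  qed
  have expectation: "expectation (\<lambda>\<omega>. F i (\<omega> 0)) = moments F P i"
  proof -
    have "expectation (\<lambda>\<omega>. F i (\<omega> 0)) = (\<integral>x. F i x \<partial>distr (iid_law P) P (\<lambda>\<omega>. \<omega> 0))"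
      by (subst integral_distr) auto
    then show ?thesis
      by (simp add: distr_iid_law_coordinate[OF P] moments_def)
  qed
  have "indep_vars (\<lambda>_. P) (\<lambda>j \<omega>. \<omega> j) {..<n}"
    by (rule indep_vars_subset[OF indep_vars_iid_law_coordinates[OF P]]) simp
  then have "indep_vars (\<lambda>_. borel) (\<lambda>j \<omega>. F i (\<omega> j)) {..<n}"
    by (rule indep_vars_compose2) (rule F_meas)
  then interpret Hoeffding_ineq_iid "iid_law P" "{..<n}" "\<lambda>j \<omega>. F i (\<omega> j)" "\<lambda>\<omega>. F i (\<omega> 0)" 0 1
      "expectation (\<lambda>\<omega>. F i (\<omega> 0))"
    using F(2) by unfold_locales (auto simp: distr)
  show ?thesis
    using Hoeffding_ineq_abs_ge'[OF \<epsilon>] n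
    by (simp add: expectation empirical_moments_def lessThan_empty_iff)
qed

text \<open>
  \<open>deviation n\<close> is chosen such that \<open>n * (deviation n)\<^sup>2\<close> is the square root of \<open>n\<close>, which keeps the
  exponential bounds summable while \<open>deviation\<close> tends to 0. The two terms of \<open>radius n\<close> bound the
  contributions of the first \<open>n + 1\<close> coordinates and of the others to the distance in
  \<open>nat \<Rightarrow> real\<close>.
\<close>

definition deviation :: "nat \<Rightarrow> real" where
  "deviation n = real n powr (- 1 / 4)"

definition radius :: "nat \<Rightarrow> real" where
  "radius n = 2 * deviation n + (1 / 2) ^ n"

definition error_bound :: "nat \<Rightarrow> real" where
  "error_bound n = 2 * (real n + 1) * exp (- 2 * sqrt (real n))"

lemma radius_tendsto_0: "radius \<longlonglongrightarrow> 0"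
  unfolding radius_def deviation_def by real_asymp

lemma summable_error_bound: "summable error_bound"
proof (rule summable_comparison_test_bigo)
  show "summable (\<lambda>n. norm (1 / real n ^ 2))"
    using inverse_power_summable[of 2, where ?'a = real] by (simp add: field_simps)
  show "error_bound \<in> O(\<lambda>n. 1 / real n ^ 2)"
    unfolding error_bound_def by real_asymp
qed

lemma empirical_moments_concentration:
  fixes F :: "nat \<Rightarrow> 'a::topological_space \<Rightarrow> real"
  assumes F: "\<And>i. continuous_on UNIV (F i)" "\<And>i x. F i x \<in> {0..1}"
    and P: "P \<in> prob_laws" and n: "n > 0"
  shows "measure (iid_law P)
           {\<omega> \<in> space (iid_law P). dist (empirical_moments F n \<omega>) (moments F P) \<ge> radius n}
         \<le> error_bound n"
proof -
  interpret prob_space "iid_law P" by (rule prob_space_iid_law[OF P])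
  note sets_iid_law[OF P, measurable_cong]
  have [measurable]: "empirical_moments F n \<in> borel_measurable (PiM UNIV (\<lambda>_. borel))"
    by (rule measurable_empirical_moments[OF F(1)]) simp
  have [measurable]: "(\<lambda>\<omega>. empirical_moments F n \<omega> i) \<in> borel_measurable (PiM UNIV (\<lambda>_. borel))" for i
    by (rule measurable_product_then_coordinatewise) measurable
  define E where "E i = {\<omega> \<in> space (iid_law P).
    \<bar>empirical_moments F n \<omega> (from_nat i) - moments F P (from_nat i)\<bar> \<ge> deviation n}" for i
  have [measurable]: "E i \<in> events" for i
    unfolding E_def by measurable
  have "{\<omega> \<in> space (iid_law P). dist (empirical_moments F n \<omega>) (moments F P) \<ge> radius n}
      \<subseteq> (\<Union>i\<in>{..n}. E i)"
  proof (rule subsetI, rule ccontr)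
    fix \<omega> assume \<omega>: "\<omega> \<in> {\<omega> \<in> space (iid_law P). dist (empirical_moments F n \<omega>) (moments F P) \<ge> radius n}"
      and "\<omega> \<notin> (\<Union>i\<in>{..n}. E i)"
    then have "dist (empirical_moments F n \<omega> (from_nat i)) (moments F P (from_nat i)) < deviation n"
      if "i \<le> n" for i
      using that by (force simp: E_def dist_real_def)
    then have "Max {dist (empirical_moments F n \<omega> (from_nat i)) (moments F P (from_nat i)) |i. i \<le> n}
        < deviation n"
      by (subst Max_less_iff) auto
    then have "dist (empirical_moments F n \<omega>) (moments F P) < radius n"
      using dist_fun_le_dist_first_terms[of "empirical_moments F n \<omega>" "moments F P" n]
      by (simp add: radius_def)
    with \<omega> show False by simp
  qed
  then have "measure (iid_law P)
      {\<omega> \<in> space (iid_law P). dist (empirical_moments F n \<omega>) (moments F P) \<ge> radius n}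
      \<le> measure (iid_law P) (\<Union>i\<in>{..n}. E i)"
    by (intro finite_measure_mono) auto
  also have "\<dots> \<le> (\<Sum>i\<le>n. measure (iid_law P) (E i))"
    by (rule measure_UNION_le) auto
  also have "\<dots> \<le> (\<Sum>i\<le>n. 2 * exp (- 2 * real n * (deviation n)\<^sup>2))"
    unfolding E_def using n
    by (intro sum_mono Hoeffding_empirical_moment[OF F P]) (auto simp: deviation_def)
  also have "real n * (deviation n)\<^sup>2 = sqrt (real n)"
  proof -
    have "real n * (deviation n)\<^sup>2 = real n powr 1 * real n powr (- 1 / 2)"
      using n by (simp add: deviation_def power2_eq_square flip: powr_add)
    also have "\<dots> = sqrt (real n)"
      by (subst powr_add[symmetric]) (simp add: powr_half_sqrt)
    finally show ?thesis .
  qed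
  then have "(\<Sum>i\<le>n. 2 * exp (- 2 * real n * (deviation n)\<^sup>2)) = error_bound n"
    by (simp add: error_bound_def mult.assoc)
  finally show ?thesis .
qed

section \<open>The test against a set of moment vectors\<close>

definition moment_test :: "(nat \<Rightarrow> 'a \<Rightarrow> real) \<Rightarrow> (nat \<Rightarrow> real) set \<Rightarrow> nat \<Rightarrow> (nat \<Rightarrow> 'a) \<Rightarrow> real" where
  "moment_test F S n x = (if \<exists>y\<in>S. dist (empirical_moments F n x) y < radius n then 0 else 1)"

text \<open>
  The strict inequality makes the acceptance region the preimage of an open set, a union of balls, so
  that the test is measurable for every \<open>S\<close>, even though the union may be uncountable.
\<close>

lemma test_sequence_moment_test:
  fixes F :: "nat \<Rightarrow> 'a::topological_space \<Rightarrow> real"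
  assumes "\<And>i. continuous_on UNIV (F i)"
  shows "test_sequence (moment_test F S)"
proof -
  have "moment_test F S n \<in> borel_measurable (PiM {..<n} (\<lambda>_. borel))" for n
  proof -
    have [measurable]: "empirical_moments F n \<in> borel_measurable (PiM {..<n} (\<lambda>_. borel))"
      by (rule measurable_empirical_moments[OF assms]) simp
    have "open (\<Union>y\<in>S. ball y (radius n))"
      by auto
    then have [measurable]: "(\<Union>y\<in>S. ball y (radius n)) \<in> sets borel"
      by (rule borel_open)
    have "moment_test F S n =
        (\<lambda>x. if empirical_moments F n x \<in> (\<Union>y\<in>S. ball y (radius n)) then 0 else 1)"
      by (auto simp: moment_test_def fun_eq_iff dist_commute)
    also have "\<dots> \<in> borel_measurable (PiM {..<n} (\<lambda>_. borel))"
      by measurable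
    finally show ?thesis .
  qed
  then show ?thesis
    by (simp add: test_sequence_def moment_test_def)
qed

text \<open>
  Both errors of the test force the empirical moments away from the true ones. For a law in \<open>B\<close>
  this is the triangle inequality, once the radius is at most half of the distance \<open>\<delta>\<close>.
\<close>

lemma moment_test_uniformly_discerns:
  fixes F :: "nat \<Rightarrow> 'a::topological_space \<Rightarrow> real"
  assumes F: "\<And>i. continuous_on UNIV (F i)" "\<And>i x. F i x \<in> {0..1}"
    and A: "A \<subseteq> prob_laws" "moments F ` A \<subseteq> S"
    and B: "B \<subseteq> prob_laws" "\<And>P y. P \<in> B \<Longrightarrow> y \<in> S \<Longrightarrow> \<delta> \<le> dist (moments F P) y" and \<delta>: "\<delta> > 0"
  shows "uniformly_discerns (moment_test F S) A B"
proof -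
  have "eventually (\<lambda>n. radius n < \<delta> / 2) sequentially"
    using radius_tendsto_0 \<delta> by (intro order_tendstoD) auto
  then obtain m where m: "\<And>n. n \<ge> m \<Longrightarrow> radius n < \<delta> / 2"
    by (auto simp: eventually_sequentially)
  let ?K = "moment_test F S"
  have error: "measure (iid_law P) {\<omega> \<in> space (iid_law P). ?K n (restrict \<omega> {..<n}) \<noteq> c} \<le> error_bound n"
    if P: "P \<in> prob_laws" and n: "n > 0"
      and *: "\<And>\<omega>. ?K n \<omega> \<noteq> c \<Longrightarrow> radius n \<le> dist (empirical_moments F n \<omega>) (moments F P)"
    for P n c
  proof -
    interpret prob_space "iid_law P" by (rule prob_space_iid_law[OF P])
    note sets_iid_law[OF P, measurable_cong]
    have [measurable]: "empirical_moments F n \<in> borel_measurable (PiM UNIV (\<lambda>_. borel))"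
      by (rule measurable_empirical_moments[OF F(1)]) simp
    have "measure (iid_law P) {\<omega> \<in> space (iid_law P). ?K n (restrict \<omega> {..<n}) \<noteq> c}
        \<le> measure (iid_law P)
          {\<omega> \<in> space (iid_law P). dist (empirical_moments F n \<omega>) (moments F P) \<ge> radius n}"
      using *[of "restrict _ {..<n}"]
      by (intro finite_measure_mono) (auto simp: empirical_moments_restrict)
    also have "\<dots> \<le> error_bound n"
      by (rule empirical_moments_concentration[OF F P n])
    finally show ?thesis .
  qed
  show ?thesis
  proof (rule uniformly_discerns_if_summable_errors[where b = error_bound and m = "Suc m"])
    fix P n assume P: "P \<in> A" and n: "Suc m \<le> n"
    show "measure (iid_law P) {\<omega> \<in> space (iid_law P). ?K n (restrict \<omega> {..<n}) \<noteq> 0} \<le> error_bound n"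
    proof (rule error)
      show "radius n \<le> dist (empirical_moments F n \<omega>) (moments F P)" if "?K n \<omega> \<noteq> 0" for \<omega>
        using that P A(2) by (force simp: moment_test_def split: if_splits)
    qed (use P A n in auto)
  next
    fix P n assume P: "P \<in> B" and n: "Suc m \<le> n"
    show "measure (iid_law P) {\<omega> \<in> space (iid_law P). ?K n (restrict \<omega> {..<n}) \<noteq> 1} \<le> error_bound n"
    proof (rule error)
      fix \<omega> assume "?K n \<omega> \<noteq> 1"
      then obtain y where y: "y \<in> S" "dist (empirical_moments F n \<omega>) y < radius n"
        by (auto simp: moment_test_def split: if_splits)
      have "\<delta> \<le> dist (empirical_moments F n \<omega>) (moments F P) + dist (empirical_moments F n \<omega>) y"
        using B(2)[OF P y(1)] dist_triangle3[of "moments F P" y "empirical_moments F n \<omega>"] by linarith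
      then show "radius n \<le> dist (empirical_moments F n \<omega>) (moments F P)"
        using y(2) m[of n] n by linarith
    qed (use P B n in auto)
  qed (use A B F summable_error_bound in \<open>auto simp: test_sequence_moment_test error_bound_def\<close>)
qed

section \<open>Relatively compact hypotheses\<close>

theorem theorem2p7:
  fixes \<Theta>\<^sub>0 :: "'a::polish_space measure set"
  assumes "\<Theta>\<^sub>0 \<subseteq> prob_laws"
    and "relatively_compact_laws \<Theta>\<^sub>0"
  shows "uniformly_asymptotically_discernible \<Theta>\<^sub>0"
proof -
  obtain F :: "nat \<Rightarrow> 'a \<Rightarrow> real" where F: "\<And>i. continuous_on UNIV (F i)" "\<And>i x. F i x \<in> {0..1}"
    and determining: "\<And>P Q. P \<in> prob_laws \<Longrightarrow> Q \<in> prob_laws \<Longrightarrow>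
      (\<And>i. (\<integral>x. F i x \<partial>P) = (\<integral>x. F i x \<partial>Q)) \<Longrightarrow> P = Q"
    using measure_determining_sequence by blast
  define C where "C = weak_topology closure_of \<Theta>\<^sub>0"
  define S where "S = moments F ` C"
  define \<Theta> where "\<Theta> k = {P \<in> prob_laws. \<forall>y\<in>S. 1 / real k \<le> dist (moments F P) y}" for k
  have C: "C \<subseteq> prob_laws" "\<Theta>\<^sub>0 \<subseteq> C"
    using closure_of_subset_topspace[of weak_topology \<Theta>\<^sub>0] closure_of_subset[of \<Theta>\<^sub>0 weak_topology] assms(1)
    by (auto simp: C_def topspace_weak_topology)
  have "bounded (range (F i))" for i
    using F(2) by (intro bounded_subset[OF bounded_closed_interval[of 0 1]]) auto
  then have "continuous_map weak_topology euclidean (moments F)"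
    by (rule continuous_map_moments[OF F(1)])
  then have "compactin euclidean S"
    using assms(2) unfolding S_def C_def relatively_compact_laws_def by (intro image_compactin)
  then have "closed S"
    by (simp add: compact_imp_closed)
  have "(\<Union>k\<in>{1..}. \<Theta> k) \<union> C = prob_laws"
  proof
    show "(\<Union>k\<in>{1..}. \<Theta> k) \<union> C \<subseteq> prob_laws"
      using C by (auto simp: \<Theta>_def)
    show "prob_laws \<subseteq> (\<Union>k\<in>{1..}. \<Theta> k) \<union> C"
    proof
      fix P :: "'a measure" assume P: "P \<in> prob_laws"
      show "P \<in> (\<Union>k\<in>{1..}. \<Theta> k) \<union> C"
      proof (cases "P \<in> C")
        case False
        have "moments F P \<notin> S"
        proof
          assume "moments F P \<in> S"
          then obtain Q where Q: "Q \<in> C" "moments F P = moments F Q"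
            by (auto simp: S_def)
          then have "P = Q"
            using C P by (intro determining) (auto simp: moments_def fun_eq_iff)
          with Q False show False by simp
        qed
        then obtain e where e: "e > 0" "ball (moments F P) e \<subseteq> - S"
          using \<open>closed S\<close> by (metis ComplI open_Compl open_contains_ball)
        then obtain k where k: "1 / real (Suc k) < e"
          using nat_approx_posE by blast
        have "1 / real (Suc k) \<le> dist (moments F P) y" if "y \<in> S" for y
          using that e(2) k by (force simp: subset_iff)
        then have "P \<in> \<Theta> (Suc k)"
          using P by (simp add: \<Theta>_def)
        then show ?thesis
          by (auto intro!: bexI[of _ "Suc k"])
      qed auto
    qed
  qed
  moreover have "\<Theta> k \<subseteq> prob_laws \<and> \<Theta> k \<subseteq> \<Theta> (k + 1)" if "k \<ge> 1" for k
  proof -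
    have "1 / real (k + 1) \<le> 1 / real k"
      using that by (intro divide_left_mono) auto
    then show ?thesis
      unfolding \<Theta>_def by (auto intro: order_trans)
  qed
  moreover have "uniformly_discerns (moment_test F S) \<Theta>\<^sub>0 (\<Theta> k)" if "k \<ge> 1" for k
    by (rule moment_test_uniformly_discerns[OF F assms(1), where \<delta> = "1 / real k"])
      (use C(2) that in \<open>auto simp: S_def \<Theta>_def\<close>)
  ultimately show ?thesis
    unfolding uniformly_asymptotically_discernible_def C_def
    by (intro exI[of _ \<Theta>] exI[of _ "moment_test F S"] conjI allI impI
        test_sequence_moment_test F(1)) simp_all
qed

end
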